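(* Let $a_n,b_n,c_n:\mathbb{R}\to\mathbb{C}$ ($n\in\mathbb{N}$) be differentiable functions of $t\in\mathbb{R}$ such that there exists $K\in\mathbb{R}_+$ with $\max\{|a_n(t)|,|b_n(t)|,|c_n(t)|\}\le K$ for all $n\in\mathbb{N}$, $t\in\mathbb{R}$, $c_n(t)\ne0$ for all $n\in\mathbb{N}$, $t\in\mathbb{R}$, and $\dot a_1=b_1$. Let $\mathcal{U}$ be the vector of functionals defined in the context, and assume that for each $t\in\mathbb{R}$ $$\mathcal{U}=\left(e^{zt}\,\mathcal{U}_0\right)_M$$ for some $M\in\mathcal{M}_{2\times2}$ (which may depend on $t$). Then $\{a_n,b_n,c_n\}_{n\in\mathbb{N}}$ is a solution of $$\dot a_n=b_n-b_{n-1},\qquad \dot b_n=b_n(a_{n+1}-a_n)+c_n-c_{n-1},\qquad \dot c_n=c_n(a_{n+2}-a_n),\qquad n\in\mathbb{N},$$ with $b_0\equiv0$, $c_0\equiv0$.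
   Context: $\mathbb{N}=\{1,2,\dots\}$. The dot denotes differentiation with respect to $t\in\mathbb{R}$; dependence on $t$ is suppressed. $\mathcal{M}_{2\times2}$ is the space of complex $2\times2$ matrices, $\mathcal{O}_2$ its zero. Polynomials $P_n$ (depending on $t$): $P_0=1$, $P_{-1}=P_{-2}=0$, $c_{n-1}P_{n-2}(z)+b_nP_{n-1}(z)+(a_{n+1}-z)P_n(z)+P_{n+1}(z)=0$ for $n=0,1,\dots$ (terms containing $P_{-1}$ or $P_{-2}$ vanish). $\mathcal{B}_m(z)=(P_{2m}(z),P_{2m+1}(z))^T$, so $\mathcal{B}_0(z)=(1,z-a_1)^T$. For $n\in\mathbb{N}$, $C_n=\begin{pmatrix}c_{2n-1}&b_{2n}\\0&c_{2n}\end{pmatrix}$, and $C_0=\begin{pmatrix}1&0\\-a_1&1\end{pmatrix}$. $\mathcal{P}$ is the space of complex polynomials in $z$ and $\mathcal{P}^2=\{(q_1,q_2)^T:q_1,q_2\in\mathcal{P}\}$. A vector of functionals associated with the recurrence relation for $\{P_n\}$ is a map $\mathcal{W}:\mathcal{P}^2\to\mathcal{M}_{2\times2}$, $$\mathcal{W}\begin{pmatrix}q_1\\ q_2\end{pmatrix}=\begin{pmatrix}u^1[q_1]&u^2[q_1]\\ u^1[q_2]&u^2[q_2]\end{pmatrix},$$ where $u^1,u^2:\mathcal{P}\to\mathbb{C}$ are linear functionals such that for all $m\in\mathbb{N}$: $u^i[z^jP_{2m}]=u^i[z^jP_{2m+1}]=0$ for $j=0,\dots,m-1$, $i=1,2$,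 and $u^1[z^mP_{2m+1}]=0$. For any map $\mathcal{W}:\mathcal{P}^2\to\mathcal{M}_{2\times2}$ and $M\in\mathcal{M}_{2\times2}$ put $\mathcal{W}_M(\mathcal{Q})=\mathcal{W}(\mathcal{Q})M$. For each $t$ a vector of functionals $\mathcal{W}$ associated with the recurrence is fixed such that $\mathcal{W}(\mathcal{B}_0)$ is invertible, and $\mathcal{U}=\mathcal{W}_{M'}$ with $M'=(\mathcal{W}(\mathcal{B}_0))^{-1}C_0$. Then $\mathcal{U}$ satisfies, for each $m\in\mathbb{N}\cup\{0\}$, $\mathcal{U}(z^j\mathcal{B}_m)=\mathcal{O}_2$ for $j=0,\dots,m-1$ and $\mathcal{U}(z^m\mathcal{B}_m)=C_mC_{m-1}\cdots C_0$. For a linear functional $u:\mathcal{P}\to\mathbb{C}$, $e^{zt}u:\mathcal{P}\to\mathbb{C}$ is the linear functional with $(e^{zt}u)[z^j]=\sum_{k\ge0}\frac{t^k}{k!}u[z^{k+j}]$, whenever the series converge. $\mathcal{U}_0$ denotes $\mathcal{U}$ at $t=0$; it is given by a pair of linear functionals $u_0^1,u_0^2$ through $\mathcal{U}_0\begin{pmatrix}q_1\\ q_2\end{pmatrix}=\begin{pmatrix}u_0^1[q_1]&u_0^2[q_1]\\ u_0^1[q_2]&u_0^2[q_2]\end{pmatrix}$ (the series defining $e^{zt}u_0^i$ converge under the boundedness hypothesis), and $$(e^{zt}\,\mathcal{U}_0)\begin{pmatrix}q_1\\ q_2\end{pmatrix}=\begin{pmatrix}(e^{zt}u_0^1)[q_1]&(e^{zt}u_0^2)[q_1]\\(e^{zt}u_0^1)[q_2]&(e^{zt}u_0^2)[q_2]\end{pmatrix}.$$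 *)

theory Defs
  imports "HOL-Analysis.Analysis" "HOL-Computational_Algebra.Polynomial"
begin

text \<open>Sequences \<open>a\<close>, \<open>b\<close>, \<open>c\<close> are indexed from 1; the values at index 0 are not used
  by the definitions below, which take the sequences at a fixed time.\<close>

fun rec_poly :: "(nat \<Rightarrow> complex) \<Rightarrow> (nat \<Rightarrow> complex) \<Rightarrow> (nat \<Rightarrow> complex) \<Rightarrow> nat \<Rightarrow> complex poly"
  where
    "rec_poly a b c 0 = 1"
  | "rec_poly a b c (Suc n) =
       ([:0, 1:] - [:a (n + 1):]) * rec_poly a b c n
       - (if n \<ge> 1 then smult (b n) (rec_poly a b c (n - 1)) else 0)
       - (if n \<ge> 2 then smult (c (n - 1)) (rec_poly a b c (n - 2)) else 0)"

definition block ::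
  "(nat \<Rightarrow> complex) \<Rightarrow> (nat \<Rightarrow> complex) \<Rightarrow> (nat \<Rightarrow> complex) \<Rightarrow> nat \<Rightarrow> complex poly ^ 2"
  where "block a b c m = vector [rec_poly a b c (2 * m), rec_poly a b c (2 * m + 1)]"

definition C0 :: "(nat \<Rightarrow> complex) \<Rightarrow> complex ^ 2 ^ 2"
  where "C0 a = vector [vector [1, 0], vector [- a 1, 1]]"

abbreviation linear_functional :: "(complex poly \<Rightarrow> complex) \<Rightarrow> bool"
  where "linear_functional u \<equiv> Vector_Spaces.linear smult (*) u"

definition functional_pair ::
  "(complex poly \<Rightarrow> complex) \<Rightarrow> (complex poly \<Rightarrow> complex) \<Rightarrow> complex poly ^ 2 \<Rightarrow> complex ^ 2 ^ 2"
  where "functional_pair u1 u2 q =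
    vector [vector [u1 (q $ 1), u2 (q $ 1)],
            vector [u1 (q $ 2), u2 (q $ 2)]]"

definition associated_functional ::
  "(nat \<Rightarrow> complex) \<Rightarrow> (nat \<Rightarrow> complex) \<Rightarrow> (nat \<Rightarrow> complex)
    \<Rightarrow> (complex poly ^ 2 \<Rightarrow> complex ^ 2 ^ 2) \<Rightarrow> bool"
  where "associated_functional a b c W \<longleftrightarrow>
    (\<exists>u1 u2. linear_functional u1 \<and> linear_functional u2 \<and> W = functional_pair u1 u2 \<and>
      (\<forall>m\<ge>1.
        (\<forall>j<m. \<forall>u\<in>{u1, u2}.
          u (monom 1 j * rec_poly a b c (2 * m)) = 0 \<and>
          u (monom 1 j * rec_poly a b c (2 * m + 1)) = 0) \<and>
        u1 (monom 1 m * rec_poly a b c (2 * m + 1)) = 0))"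

definition right_mult ::
  "(complex poly ^ 2 \<Rightarrow> complex ^ 2 ^ 2) \<Rightarrow> complex ^ 2 ^ 2 \<Rightarrow> complex poly ^ 2 \<Rightarrow> complex ^ 2 ^ 2"
  where "right_mult W M q = W q ** M"

text \<open>The functional \<open>e\<^sup>z\<^sup>t u\<close>: its value on \<open>z\<^sup>j\<close> is the inner series, extended linearly to all
  polynomials. It is meaningful only where these series converge.\<close>

definition exp_functional :: "real \<Rightarrow> (complex poly \<Rightarrow> complex) \<Rightarrow> complex poly \<Rightarrow> complex"
  where "exp_functional t u q =
    (\<Sum>j\<le>degree q. coeff q j * (\<Sum>k. of_real t ^ k / fact k * u (monom 1 (k + j))))"

end

theory Submission
  imports Defs
begin

text \<open>
  Only the vanishing of the functionals on \<open>P\<^sub>n\<close> for \<open>n \<ge> 2\<close> is needed. The functionals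
  \<open>e\<^sup>z\<^sup>t u\<^sub>0\<^sup>i\<close> differ from those of \<open>\<U>\<close> by an invertible matrix, so they annihilate \<open>P\<^sub>n\<close>,
  \<open>n \<ge> 2\<close>, at time \<open>t\<close> and are independent on the span of \<open>P\<^sub>0, P\<^sub>1\<close>. Differentiating in \<open>t\<close>,
  they annihilate \<open>dP\<^sub>n/dt + z P\<^sub>n\<close>, hence also
  \<open>D\<^sub>n = dP\<^sub>n/dt + b\<^sub>n P\<^sub>n\<^sub>-\<^sub>1 + c\<^sub>n\<^sub>-\<^sub>1 P\<^sub>n\<^sub>-\<^sub>2\<close>; for \<open>D\<^sub>1\<close> this is the hypothesis \<open>da\<^sub>1/dt = b\<^sub>1\<close>.
  Thus every \<open>D\<^sub>n\<close> has vanishing \<open>P\<^sub>0\<close>- and \<open>P\<^sub>1\<close>-components. The sequence \<open>D\<close> satisfies the recurrence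
  of \<open>P\<close> up to a combination of \<open>P\<^sub>n, P\<^sub>n\<^sub>-\<^sub>1, P\<^sub>n\<^sub>-\<^sub>2\<close> whose coefficients are exactly the defects in
  the three differential equations. As \<open>c\<^sub>k \<noteq> 0\<close>, comparing \<open>P\<^sub>k\<close>-components for \<open>k \<le> n - 3\<close> shows
  successively that all components of all \<open>D\<^sub>n\<close> vanish, and then so do the three coefficients.
\<close>

section \<open>Linear functionals on complex polynomials\<close>

lemma linear_functional_iff:
  "linear_functional u \<longleftrightarrow>
    (\<forall>p q. u (p + q) = u p + u q) \<and> (\<forall>r p. u (smult r p) = r * u p)"
proof
  assume "linear_functional u"
  then have "module_hom smult (*) u"
    by (simp add: Vector_Spaces.linear_def)
  then show "(\<forall>p q. u (p + q) = u p + u q) \<and> (\<forall>r p. u (smult r p) = r * u p)"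
    by (simp add: module_hom.add module_hom.scale)
next
  assume *: "(\<forall>p q. u (p + q) = u p + u q) \<and> (\<forall>r p. u (smult r p) = r * u p)"
  have "vector_space (smult :: complex \<Rightarrow> _)" "vector_space ((*) :: complex \<Rightarrow> complex \<Rightarrow> complex)"
    by (unfold_locales; simp add: algebra_simps smult_add_left smult_add_right)+
  with * show "linear_functional u"
    by (simp add: Vector_Spaces.linear_def module_hom_def module_hom_axioms_def
        vector_space_def module_def)
qed

lemma
  assumes "linear_functional u"
  shows linear_functional_add: "u (p + q) = u p + u q"
    and linear_functional_smult: "u (smult r p) = r * u p"
    and linear_functional_zero: "u 0 = 0"
    and linear_functional_diff: "u (p - q) = u p - u q"
proof -
  from assms show add: "u (p + q) = u p + u q" and smult: "u (smult r p) = r * u p" for p q r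
    by (auto simp: linear_functional_iff)
  show "u 0 = 0"
    using smult [of 0 0] by simp
  show "u (p - q) = u p - u q"
    using add [of p "- q"] smult [of "-1" q] by simp
qed

lemma linear_functional_combination:
  assumes "linear_functional u" "linear_functional v"
  shows "linear_functional (\<lambda>q. (r * u q - s * v q) / d)"
  using assms unfolding linear_functional_iff
  by (simp add: algebra_simps add_divide_distrib diff_divide_distrib)

lemmas linear_functional_simps =
  linear_functional_add linear_functional_smult linear_functional_zero linear_functional_diff


subsection \<open>The algebraic core\<close>

text \<open>The recurrence and its formal time derivative at a fixed time, with \<open>dp\<close> in the role of
  \<open>dP\<^sub>n/dt\<close>. Since \<open>b\<close> and \<open>c\<close> vanish at index 0, truncated subtraction is harmless.\<close>

locale recurrence_flow =
  fixes a b c da db dc :: "nat \<Rightarrow> complex" and p dp :: "nat \<Rightarrow> complex poly"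
    and \<phi> \<psi> :: "complex poly \<Rightarrow> complex"
  assumes zero: "b 0 = 0" "c 0 = 0" "db 0 = 0" "dc 0 = 0"
    and c_nonzero: "n \<ge> 1 \<Longrightarrow> c n \<noteq> 0"
    and p_0: "p 0 = 1" and dp_0: "dp 0 = 0"
    and p_Suc: "p (Suc n) = pCons 0 (p n) - smult (a (Suc n)) (p n)
      - smult (b n) (p (n - 1)) - smult (c (n - 1)) (p (n - 2))"
    and dp_Suc: "dp (Suc n) = pCons 0 (dp n) - smult (a (Suc n)) (dp n)
      - smult (b n) (dp (n - 1)) - smult (c (n - 1)) (dp (n - 2))
      - smult (da (Suc n)) (p n) - smult (db n) (p (n - 1)) - smult (dc (n - 1)) (p (n - 2))"
    and linear: "linear_functional \<phi>" "linear_functional \<psi>"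
    and \<phi>_p: "\<phi> (p n) = (if n = 0 then 1 else 0)"
    and \<psi>_p: "\<psi> (p n) = (if n = 1 then 1 else 0)"
    and \<phi>_dp: "n \<ge> 2 \<Longrightarrow> \<phi> (dp n) + \<phi> (pCons 0 (p n)) = 0"
    and \<psi>_dp: "n \<ge> 2 \<Longrightarrow> \<psi> (dp n) + \<psi> (pCons 0 (p n)) = 0"
    and da_1: "da 1 = b 1"
begin

lemma pCons_p:
  "pCons 0 (p n) = p (Suc n) + smult (a (Suc n)) (p n)
    + smult (b n) (p (n - 1)) + smult (c (n - 1)) (p (n - 2))"
  by (simp add: p_Suc)

text \<open>The dual basis of \<open>p\<close>, obtained by solving for \<open>dual (k + 2)\<close> in the transposed
  recurrence.\<close>

fun dual :: "nat \<Rightarrow> complex poly \<Rightarrow> complex" where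
  "dual 0 = \<phi>"
| "dual (Suc 0) = \<psi>"
| "dual (Suc (Suc k)) = (\<lambda>q. (dual k (pCons 0 q) - a (Suc k) * dual k q
      - b (Suc k) * dual (Suc k) q - (if k = 0 then 0 else dual (k - 1) q)) / c (Suc k))"

lemma dual_pCons:
  "dual k (pCons 0 q) = c (Suc k) * dual (Suc (Suc k)) q + b (Suc k) * dual (Suc k) q
    + a (Suc k) * dual k q + (if k = 0 then 0 else dual (k - 1) q)"
  using c_nonzero [of "Suc k"] by (simp)

declare dual.simps(3) [simp del]

lemma linear_dual: "linear_functional (dual k)"
proof (induction k rule: dual.induct)
  case (3 k)
  have lin: "linear_functional (dual k)" "linear_functional (dual (Suc k))"
    "k \<noteq> 0 \<Longrightarrow> linear_functional (dual (k - 1))"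
    using 3 by auto
  have "dual k (pCons 0 (q + r)) = dual k (pCons 0 q) + dual k (pCons 0 r)"
    "dual k (pCons 0 (smult s q)) = s * dual k (pCons 0 q)" for q r s
    by (simp_all flip: linear_functional_add [OF lin(1)] linear_functional_smult [OF lin(1)])
  then show ?case
    using lin unfolding linear_functional_iff dual.simps(3)
    by (auto simp: algebra_simps diff_divide_distrib add_divide_distrib)
qed (simp_all add: linear)

lemmas dual_simps = linear_functional_simps [OF linear_dual]

lemma dual_p: "dual k (p n) = (if n = k then 1 else 0)"
proof (induction k arbitrary: n rule: dual.induct)
  case (3 k)
  have IH: "dual k (p n) = (if n = k then 1 else 0)"
    "dual (Suc k) (p n) = (if n = Suc k then 1 else 0)"
    "k \<noteq> 0 \<Longrightarrow> dual (k - 1) (p n) = (if n = k - 1 then 1 else 0)" for n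
    using 3 by auto
  have "dual k (pCons 0 (p n)) = (if Suc n = k then 1 else 0)
      + a (Suc n) * (if n = k then 1 else 0) + b n * (if n - 1 = k then 1 else 0)
      + c (n - 1) * (if n - 2 = k then 1 else 0)"
    unfolding pCons_p dual_simps IH ..
  moreover have "(if k = 0 then 0 else dual (k - 1) (p n)) = (if Suc n = k then 1 else 0)"
    using IH(3) by auto
  \<comment> \<open>At \<open>n = 0\<close> truncation makes \<open>n - 1\<close> match
    \<open>k = 0\<close> spuriously; \<open>b 0 = 0\<close> removes this, and \<open>c 0 = 0\<close>
    does the same below.\<close>
  moreover have "b n * (if n - 1 = k then 1 else 0) = b (Suc k) * (if n = Suc k then 1 else 0)"
    by (cases n) (auto simp: zero)
  moreover have "c (n - 1) * (if n - 2 = k then 1 else 0)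
      = c (Suc k) * (if n = Suc (Suc k) then 1 else 0)"
    by (cases n; cases "n - 1") (auto simp: zero)
  ultimately have "c (Suc k) * dual (Suc (Suc k)) (p n) = (if n = Suc (Suc k) then c (Suc k) else 0)"
    using dual_pCons [of k "p n"] IH by (auto split: if_splits)
  then show ?case
    using c_nonzero [of "Suc k"] by (auto split: if_splits)
qed (simp_all add: \<phi>_p \<psi>_p)

text \<open>Reflects that P_n is monic, so that its time derivative has lower degree. In the
  induction \<open>dual_pCons\<close> lowers the index of \<open>dual\<close> by at most one, while
  \<open>n\<close> drops by at least one.\<close>

lemma dual_dp_eq_0: "n \<le> k \<Longrightarrow> dual k (dp n) = 0"
proof (induction n arbitrary: k rule: less_induct)
  case (less n)
  show ?case
  proof (cases n)
    case 0
    then show ?thesis by (simp add: dp_0 dual_simps)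
  next
    case (Suc m)
    then show ?thesis
      using less unfolding Suc dp_Suc dual_simps dual_pCons dual_p by auto
  qed
qed

text \<open>Its vanishing says that P_n evolves by minus the strictly lower triangular part of
  multiplication by z: a Lax equation.\<close>

definition defect :: "nat \<Rightarrow> complex poly" where
  "defect n = dp n + smult (b n) (p (n - 1)) + smult (c (n - 1)) (p (n - 2))"

text \<open>A commutator computation: the strictly lower part commutes with itself, so only
  diagonals 0, -1 and -2 survive. Their coefficients are the errors in the equations for
  \<open>a (n + 1)\<close>, \<open>b n\<close> and \<open>c (n - 1)\<close>.\<close>

lemma pCons_defect:
  "pCons 0 (defect n) = defect (Suc n) + smult (a (Suc n)) (defect n)
    + smult (b n) (defect (n - 1)) + smult (c (n - 1)) (defect (n - 2))
    + smult (da (Suc n) + b n - b (Suc n)) (p n)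
    + smult (db n - b n * (a (Suc n) - a n) - c n + c (n - 1)) (p (n - 1))
    + smult (dc (n - 1) - c (n - 1) * (a (Suc n) - a (n - 1))) (p (n - 2))"
proof -
  consider "n = 0" | "n = 1" | m where "n = Suc (Suc m)"
    by (metis One_nat_def old.nat.exhaust)
  then show ?thesis
  proof cases
    case 3
    have "poly (pCons 0 (defect n)) x = poly (defect (Suc n) + smult (a (Suc n)) (defect n)
      + smult (b n) (defect (n - 1)) + smult (c (n - 1)) (defect (n - 2))
      + smult (da (Suc n) + b n - b (Suc n)) (p n)
      + smult (db n - b n * (a (Suc n) - a n) - c n + c (n - 1)) (p (n - 1))
      + smult (dc (n - 1) - c (n - 1) * (a (Suc n) - a (n - 1))) (p (n - 2))) x" for x
      unfolding 3 defect_def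
      by (simp add: dp_Suc [of "Suc (Suc m)"] p_Suc [of "Suc m"] p_Suc [of m] algebra_simps)
    then show ?thesis
      by (auto simp flip: poly_eq_poly_eq_iff)
  qed (simp_all add: defect_def zero dp_0 p_0 dp_Suc p_Suc da_1 algebra_simps smult_add_left smult_diff_left)
qed

lemma dual_defect: "dual k (defect n) = 0"
proof (induction k arbitrary: n rule: less_induct)
  case (less k)
  \<comment> \<open>For \<open>i \<le> 1\<close> and \<open>n \<ge> 2\<close>, z P_n has no
    contribution from P_{n+1} or P_n, so the hypothesis on \<open>dp n\<close> is already one on
    \<open>defect n\<close>.\<close>
  have base: "dual i (defect n) = 0" if "i \<le> 1" "\<And>n. n \<ge> 2 \<Longrightarrow> dual i (dp n) + dual i (pCons 0 (p n)) = 0"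
    for i
  proof -
    consider "n = 0" | "n = 1" | "n \<ge> 2" by linarith
    then show ?thesis
    proof cases
      case 3
      then have "dual i (pCons 0 (p n)) = b n * dual i (p (n - 1)) + c (n - 1) * dual i (p (n - 2))"
        using that(1) unfolding pCons_p dual_simps by (simp add: dual_p)
      then show ?thesis
        using that(2) [OF 3] by (simp add: defect_def dual_simps algebra_simps)
    qed (use da_1 in \<open>simp_all add: defect_def zero dp_0 p_0 dp_Suc dual_simps\<close>)
  qed
  consider "k = 0" | "k = Suc 0" | l where "k = Suc (Suc l)"
    by (metis old.nat.exhaust)
  then show ?case
  proof cases
    case 3
    show ?thesis
    proof (cases "n \<le> k")
      case True
      then show ?thesis
        by (cases n) (auto simp: defect_def dual_simps dual_dp_eq_0 dual_p zero)
    next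
      case False
      have IH: "dual l (defect m) = 0" "dual (Suc l) (defect m) = 0" "dual (l - 1) (defect m) = 0" for m
        using less.IH 3 by simp_all
      \<comment> \<open>Here \<open>n > l + 2\<close>, so \<open>n\<close>, \<open>n - 1\<close> and
        \<open>n - 2\<close> all exceed \<open>l\<close> and the error terms have no component at
        \<open>l\<close>.\<close>
      have "dual l (pCons 0 (defect n)) = 0"
        unfolding pCons_defect dual_simps IH dual_p using False 3 by auto
      then show ?thesis
        using c_nonzero [of "Suc l"] unfolding dual_pCons IH 3 by simp
    qed
  qed (use base [of k] \<phi>_dp \<psi>_dp in simp_all)
qed

lemma dual_remainder:
  "(da (Suc n) + b n - b (Suc n)) * dual k (p n)
    + (db n - b n * (a (Suc n) - a n) - c n + c (n - 1)) * dual k (p (n - 1))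
    + (dc (n - 1) - c (n - 1) * (a (Suc n) - a (n - 1))) * dual k (p (n - 2)) = 0"
proof -
  have "dual k (pCons 0 (defect n)) = 0"
    unfolding dual_pCons by (simp add: dual_defect)
  then show ?thesis
    unfolding pCons_defect dual_simps by (simp add: dual_defect)
qed

lemma toda_equations:
  assumes "n \<ge> 1"
  shows "da n = b n - b (n - 1)"
    and "db n = b n * (a (n + 1) - a n) + c n - c (n - 1)"
    and "dc n = c n * (a (n + 2) - a n)"
proof -
  obtain m where n: "n = Suc m"
    using assms by (cases n) auto
  \<comment> \<open>Component \<open>m\<close> of the error terms at index \<open>m\<close>,
    \<open>m + 1\<close>, \<open>m + 2\<close> isolates the first, second and third coefficient in
    turn.\<close>
  show "da n = b n - b (n - 1)"
    using dual_remainder [of m m] unfolding dual_p n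
    by (cases m; cases "m - 1") (auto simp: zero algebra_simps)
  show "db n = b n * (a (n + 1) - a n) + c n - c (n - 1)"
    using dual_remainder [of "Suc m" m] unfolding dual_p n
    by (cases m) (auto simp: zero algebra_simps)
  show "dc n = c n * (a (n + 2) - a n)"
    using dual_remainder [of "Suc (Suc m)" m] unfolding dual_p n
    by (auto simp: algebra_simps)
qed

end


subsection \<open>Functionals annihilating the recurrence polynomials\<close>

lemma rec_poly_Suc:
  assumes "b 0 = 0" "c 0 = 0"
  shows "rec_poly a b c (Suc n) = pCons 0 (rec_poly a b c n) - smult (a (Suc n)) (rec_poly a b c n)
    - smult (b n) (rec_poly a b c (n - 1)) - smult (c (n - 1)) (rec_poly a b c (n - 2))"
proof -
  consider "n = 0" | "n = 1" | "n \<ge> 2"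
    by linarith
  then show ?thesis
    using assms by cases (simp_all add: left_diff_distrib)
qed

text \<open>Makes the series for \<open>exp_functional\<close> converge. The recurrence writes z P_n
  as four terms whose coefficients have moduli at most 1, K, K, K, whence the rate
  \<open>3 * K + 1\<close>.\<close>

lemma moment_bound:
  assumes u: "linear_functional u"
    and zero: "b 0 = 0" "c 0 = 0"
    and K: "K \<ge> 0" "\<And>n. n \<ge> 1 \<Longrightarrow> cmod (a n) \<le> K" "\<And>n. n \<ge> 1 \<Longrightarrow> cmod (b n) \<le> K"
      "\<And>n. n \<ge> 1 \<Longrightarrow> cmod (c n) \<le> K"
    and vanish: "\<And>n. n \<ge> 2 \<Longrightarrow> u (rec_poly a b c n) = 0"
  obtains B where "\<And>k. cmod (u (monom 1 k)) \<le> B * (3 * K + 1) ^ k"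
proof
  define P where "P = rec_poly a b c"
  define B where "B = cmod (u (P 0)) + cmod (u (P 1))"
  note lin = linear_functional_simps [OF u]
  have K': "cmod (a (Suc n)) \<le> K" "cmod (b n) \<le> K" "cmod (c n) \<le> K" for n
    using K zero by (cases n; simp)+
  \<comment> \<open>All \<open>n\<close> are treated at once because multiplication by z shifts
    \<open>n\<close>; \<open>k = 0\<close> holds since \<open>u\<close> kills P_n for
    \<open>n \<ge> 2\<close>.\<close>
  have bound: "cmod (u (monom 1 k * P n)) \<le> B * (3 * K + 1) ^ k" for k n
  proof (induction k arbitrary: n)
    case 0
    consider "n = 0" | "n = 1" | "n \<ge> 2"
      by linarith
    then show ?case
      by cases (auto simp: B_def P_def vanish)
  next
    case (Suc k)
    define R where "R = B * (3 * K + 1) ^ k"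
    have R: "cmod (u (monom 1 k * P n)) \<le> R" for n
      using Suc R_def by simp
    have "monom 1 (Suc k) * P n = monom 1 k * pCons 0 (P n)"
      by (simp add: monom_Suc)
    also have "pCons 0 (P n) = P (Suc n) + smult (a (Suc n)) (P n)
        + smult (b n) (P (n - 1)) + smult (c (n - 1)) (P (n - 2))"
      unfolding P_def rec_poly_Suc [of b c, OF zero] by simp
    finally have "u (monom 1 (Suc k) * P n) = u (monom 1 k * P (Suc n))
        + a (Suc n) * u (monom 1 k * P n) + b n * u (monom 1 k * P (n - 1))
        + c (n - 1) * u (monom 1 k * P (n - 2))"
      by (simp add: ring_distribs lin)
    also have "cmod \<dots> \<le> R + K * R + K * R + K * R"
      by (intro norm_triangle_le add_mono order.trans [OF norm_triangle_ineq] R)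
        (auto simp: norm_mult intro!: mult_mono K' R K)
    also have "\<dots> = B * (3 * K + 1) ^ Suc k"
      by (simp add: R_def algebra_simps)
    finally show ?case .
  qed
  show "cmod (u (monom 1 k)) \<le> B * (3 * K + 1) ^ k" for k
    using bound [of k 0] by (simp add: P_def)
qed


subsection \<open>The functional \<open>e\<^sup>z\<^sup>t u\<close>\<close>

lemma exp_functional_eq:
  assumes "degree q \<le> N"
  shows "exp_functional t u q =
    (\<Sum>j\<le>N. coeff q j * (\<Sum>k. of_real t ^ k / fact k * u (monom 1 (k + j))))"
  unfolding exp_functional_def
  by (intro sum.mono_neutral_left) (use assms in \<open>auto simp: coeff_eq_0\<close>)

text \<open>For each \<open>j\<close> the inner series is one fixed number, so linearity is
  independent of convergence.\<close>

lemma linear_exp_functional: "linear_functional (exp_functional t u)"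
  unfolding linear_functional_iff
proof (intro conjI allI)
  fix p q :: "complex poly" and r
  let ?N = "max (degree p) (degree q)"
  show "exp_functional t u (p + q) = exp_functional t u p + exp_functional t u q"
    by (simp add: exp_functional_eq [of _ ?N] degree_add_le_max algebra_simps sum.distrib)
  show "exp_functional t u (smult r p) = r * exp_functional t u p"
    by (simp add: exp_functional_eq [of _ "degree p"] degree_smult_le sum_distrib_left mult.assoc)
qed

lemma exp_functional_monom:
  "exp_functional t u (monom 1 j) = (\<Sum>k. of_real t ^ k / fact k * u (monom 1 (k + j)))"
  by (simp add: exp_functional_def degree_monom_eq coeff_monom if_distrib [of "\<lambda>x. x * _"]
      cong: if_cong)

text \<open>Differentiation in t is multiplication by z: an everywhere convergent power series is
  differentiated termwise.\<close>

lemma exp_functional_monom_deriv: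
  assumes bound: "\<And>k. cmod (u (monom 1 k)) \<le> B * L ^ k"
  shows "((\<lambda>s. exp_functional s u (monom 1 j)) has_vector_derivative
    exp_functional t u (monom 1 (Suc j))) (at t)"
proof -
  define d where "d k = u (monom 1 (k + j)) / fact k" for k
  have diffs_d: "diffs d = (\<lambda>k. u (monom 1 (k + Suc j)) / fact k)"
    by (auto simp: diffs_def d_def fun_eq_iff field_simps simp del: of_nat_Suc)
  have "summable (\<lambda>k. d k * y ^ k)" for y
  proof (rule summable_comparison_test')
    show "summable (\<lambda>k. B * L ^ j * (inverse (fact k) * (L * cmod y) ^ k))"
      by (intro summable_mult summable_exp)
    show "norm (d k * y ^ k) \<le> B * L ^ j * (inverse (fact k) * (L * cmod y) ^ k)" if "k \<ge> 0" for k
      using mult_right_mono [OF bound [of "k + j"], of "cmod y ^ k / fact k"]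
      by (simp add: d_def norm_mult norm_divide norm_power power_add power_mult_distrib field_simps)
  qed
  then have "((\<lambda>x. \<Sum>k. d k * x ^ k) has_field_derivative (\<Sum>k. diffs d k * of_real t ^ k))
      (at (of_real t))"
    by (rule termdiffs_strong_converges_everywhere)
  from has_vector_derivative_real_field [OF this] show ?thesis
    by (simp add: exp_functional_monom diffs_d d_def mult.commute)
qed


subsection \<open>Differentiating a functional along the recurrence\<close>

text \<open>The recurrence differentiated formally by the product rule.\<close>

fun rec_poly_deriv :: "(nat \<Rightarrow> complex) \<Rightarrow> (nat \<Rightarrow> complex) \<Rightarrow> (nat \<Rightarrow> complex)
    \<Rightarrow> (nat \<Rightarrow> complex) \<Rightarrow> (nat \<Rightarrow> complex) \<Rightarrow> (nat \<Rightarrow> complex) \<Rightarrow> nat \<Rightarrow> complex poly"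
  where
    "rec_poly_deriv a b c da db dc 0 = 0"
  | "rec_poly_deriv a b c da db dc (Suc n) =
       pCons 0 (rec_poly_deriv a b c da db dc n)
       - smult (a (Suc n)) (rec_poly_deriv a b c da db dc n)
       - smult (b n) (rec_poly_deriv a b c da db dc (n - 1))
       - smult (c (n - 1)) (rec_poly_deriv a b c da db dc (n - 2))
       - smult (da (Suc n)) (rec_poly a b c n) - smult (db n) (rec_poly a b c (n - 1))
       - smult (dc (n - 1)) (rec_poly a b c (n - 2))"

text \<open>The factor \<open>z\<^sup>j\<close> is there for the induction: the recurrence trades it for lower indices.\<close>

lemma functional_rec_poly_deriv:
  fixes e :: "real \<Rightarrow> complex poly \<Rightarrow> complex" and a b c :: "nat \<Rightarrow> real \<Rightarrow> complex"
  assumes linear: "\<And>s. linear_functional (e s)"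
    and e_deriv: "\<And>j. ((\<lambda>s. e s (monom 1 j)) has_vector_derivative e t (monom 1 (Suc j))) (at t)"
    and a: "\<And>n. n \<ge> 1 \<Longrightarrow> (a n has_vector_derivative da n) (at t)"
    and b: "\<And>n. (b n has_vector_derivative db n) (at t)"
    and c: "\<And>n. (c n has_vector_derivative dc n) (at t)"
    and zero: "\<And>s. b 0 s = 0" "\<And>s. c 0 s = 0"
  defines "P \<equiv> \<lambda>s. rec_poly (\<lambda>n. a n s) (\<lambda>n. b n s) (\<lambda>n. c n s)"
    and "dP \<equiv> rec_poly_deriv (\<lambda>n. a n t) (\<lambda>n. b n t) (\<lambda>n. c n t) da db dc"
  shows "((\<lambda>s. e s (monom 1 j * P s n)) has_vector_derivative
    e t (monom 1 (Suc j) * P t n + monom 1 j * dP n)) (at t)"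
proof (induction n arbitrary: j rule: less_induct)
  case (less n)
  note lin = linear_functional_simps [OF linear]
  show ?case
  proof (cases n)
    case 0
    then show ?thesis
      using e_deriv by (simp add: P_def dP_def)
  next
    case (Suc m)
    have shift: "monom 1 j * pCons 0 q = monom 1 (Suc j) * q" for j and q :: "complex poly"
      by (simp add: monom_Suc)
    have P: "P s (Suc m) = pCons 0 (P s m) - smult (a (Suc m) s) (P s m)
        - smult (b m s) (P s (m - 1)) - smult (c (m - 1) s) (P s (m - 2))" for s
      unfolding P_def by (rule rec_poly_Suc) (simp_all add: zero)
    have dP: "dP (Suc m) = pCons 0 (dP m) - smult (a (Suc m) t) (dP m) - smult (b m t) (dP (m - 1))
        - smult (c (m - 1) t) (dP (m - 2)) - smult (da (Suc m)) (P t m)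
        - smult (db m) (P t (m - 1)) - smult (dc (m - 1)) (P t (m - 2))"
      by (simp add: dP_def P_def)
    have IH: "((\<lambda>s. e s (monom 1 j * P s k)) has_vector_derivative
        e t (monom 1 (Suc j) * P t k + monom 1 j * dP k)) (at t)" if "k \<le> m" for k j
      using less.IH [of k j] that Suc by simp
    have "((\<lambda>s. e s (monom 1 (Suc j) * P s m) - a (Suc m) s * e s (monom 1 j * P s m)
        - b m s * e s (monom 1 j * P s (m - 1)) - c (m - 1) s * e s (monom 1 j * P s (m - 2)))
      has_vector_derivative
        e t (monom 1 (Suc (Suc j)) * P t m + monom 1 (Suc j) * dP m)
        - (a (Suc m) t * e t (monom 1 (Suc j) * P t m + monom 1 j * dP m)
          + da (Suc m) * e t (monom 1 j * P t m))
        - (b m t * e t (monom 1 (Suc j) * P t (m - 1) + monom 1 j * dP (m - 1))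
          + db m * e t (monom 1 j * P t (m - 1)))
        - (c (m - 1) t * e t (monom 1 (Suc j) * P t (m - 2) + monom 1 j * dP (m - 2))
          + dc (m - 1) * e t (monom 1 j * P t (m - 2)))) (at t)"
      by (intro has_vector_derivative_diff has_vector_derivative_mult IH a b c) simp_all
    then show ?thesis
      unfolding Suc P dP right_diff_distrib shift mult_smult_right lin distrib_left
      by (simp add: algebra_simps)
  qed
qed


subsection \<open>Matrix-valued functionals\<close>

lemma matrix_inv_right: "invertible A \<Longrightarrow> A ** matrix_inv A = mat 1"
  unfolding invertible_def matrix_inv_def by (rule someI2_ex) auto

lemma matrix_2_eq_iff:
  "A = B \<longleftrightarrow> A $ 1 $ 1 = B $ 1 $ 1 \<and> A $ 1 $ 2 = B $ 1 $ 2
    \<and> A $ 2 $ 1 = B $ 2 $ 1 \<and> A $ 2 $ 2 = B $ 2 $ 2"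
  for A B :: "complex ^ 2 ^ 2"
  by (auto simp: vec_eq_iff forall_2)

lemma matrix_mult_eq_0_iff:
  fixes A :: "complex ^ 2 ^ 2"
  assumes "invertible M"
  shows "A ** M = 0 \<longleftrightarrow> A = 0"
proof
  obtain N where N: "M ** N = mat 1"
    using assms by (auto simp: invertible_def)
  assume "A ** M = 0"
  then have "A ** M ** N = 0"
    by simp
  then show "A = 0"
    by (simp add: N flip: matrix_mul_assoc)
qed simp

text \<open>Orthogonality with \<open>j = 0\<close> in the block \<open>n div 2\<close>; repeating
  P_n in both entries avoids a parity distinction.\<close>

lemma associated_functional_vanish:
  assumes "associated_functional a b c W" "n \<ge> 2"
  shows "W (vector [rec_poly a b c n, rec_poly a b c n]) = 0"
proof -
  define m where "m = n div 2"
  have m: "m \<ge> 1" "n = 2 * m \<or> n = 2 * m + 1"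
    using assms(2) unfolding m_def by presburger+
  from assms(1) obtain w1 w2 where W: "W = functional_pair w1 w2"
    and "\<forall>m\<ge>1. \<forall>j<m. \<forall>u\<in>{w1, w2}. u (monom 1 j * rec_poly a b c (2 * m)) = 0
      \<and> u (monom 1 j * rec_poly a b c (2 * m + 1)) = 0"
    unfolding associated_functional_def by blast
  then have "\<forall>u\<in>{w1, w2}. u (monom 1 0 * rec_poly a b c (2 * m)) = 0
      \<and> u (monom 1 0 * rec_poly a b c (2 * m + 1)) = 0"
    using m(1) by (metis less_eq_Suc_le One_nat_def)
  then have "w1 (rec_poly a b c n) = 0" "w2 (rec_poly a b c n) = 0"
    using m(2) by (auto simp del: rec_poly.simps)
  then show ?thesis
    by (simp add: W functional_pair_def matrix_2_eq_iff del: rec_poly.simps)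
qed

text \<open>At B_0 both sides equal \<open>C0 a\<close>, of determinant 1. Hence \<open>M\<close> is
  invertible and can be cancelled, which carries the vanishing over from \<open>W\<close>.\<close>

lemma functional_pair_vanish:
  assumes W: "associated_functional a b c W" and inv: "invertible (W (block a b c 0))"
    and U: "right_mult W (matrix_inv (W (block a b c 0)) ** C0 a)
      = right_mult (functional_pair v1 v2) M"
  shows "n \<ge> 2 \<Longrightarrow> v1 (rec_poly a b c n) = 0"
    and "n \<ge> 2 \<Longrightarrow> v2 (rec_poly a b c n) = 0"
    and "v1 (rec_poly a b c 0) * v2 (rec_poly a b c 1) - v2 (rec_poly a b c 0) * v1 (rec_poly a b c 1) \<noteq> 0"
proof -
  let ?B = "block a b c 0" and ?V = "functional_pair v1 v2"
  have "?V ?B ** M = W ?B ** (matrix_inv (W ?B) ** C0 a)"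
    using fun_cong [OF U, of ?B] by (simp add: right_mult_def)
  also have "\<dots> = C0 a"
    by (simp add: matrix_mul_assoc matrix_inv_right inv)
  finally have "det (?V ?B) * det M = 1"
    unfolding det_mul [symmetric] by (simp add: det_2 C0_def)
  then have det: "det (?V ?B) \<noteq> 0" "det M \<noteq> 0"
    by auto
  then show "v1 (rec_poly a b c 0) * v2 (rec_poly a b c 1)
      - v2 (rec_poly a b c 0) * v1 (rec_poly a b c 1) \<noteq> 0"
    by (simp add: det_2 functional_pair_def block_def)
  assume n: "n \<ge> 2"
  let ?q = "vector [rec_poly a b c n, rec_poly a b c n]"
  have "?V ?q ** M = 0"
    using fun_cong [OF U, of ?q] associated_functional_vanish [OF W n]
    by (simp add: right_mult_def)
  then have "?V ?q = 0"
    using det(2) by (simp add: matrix_mult_eq_0_iff invertible_det_nz)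
  then show "v1 (rec_poly a b c n) = 0" "v2 (rec_poly a b c n) = 0"
    by (simp_all add: functional_pair_def matrix_2_eq_iff)
qed

section \<open>The Toda-type equations from the exponential evolution\<close>

theorem corollary2:
  fixes a b c :: "nat \<Rightarrow> real \<Rightarrow> complex"
    and W U :: "real \<Rightarrow> complex poly ^ 2 \<Rightarrow> complex ^ 2 ^ 2"
    and u1 u2 :: "complex poly \<Rightarrow> complex"
  assumes differentiable:
      "\<And>n t. n \<ge> 1 \<Longrightarrow> a n differentiable (at t)"
      "\<And>n t. n \<ge> 1 \<Longrightarrow> b n differentiable (at t)"
      "\<And>n t. n \<ge> 1 \<Longrightarrow> c n differentiable (at t)"
    and bounded: "\<exists>K>0. \<forall>n\<ge>1. \<forall>t. Max {cmod (a n t), cmod (b n t), cmod (c n t)} \<le> K"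
    and c_nonzero: "\<And>n t. n \<ge> 1 \<Longrightarrow> c n t \<noteq> 0"
    and deriv_a1: "\<And>t. (a 1 has_vector_derivative b 1 t) (at t)"
    and index_0: "\<And>t. b 0 t = 0" "\<And>t. c 0 t = 0"
    and W_associated:
      "\<And>t. associated_functional (\<lambda>n. a n t) (\<lambda>n. b n t) (\<lambda>n. c n t) (W t)"
    and W_invertible:
      "\<And>t. invertible (W t (block (\<lambda>n. a n t) (\<lambda>n. b n t) (\<lambda>n. c n t) 0))"
    and U_eq:
      "\<And>t. U t = right_mult (W t)
         (matrix_inv (W t (block (\<lambda>n. a n t) (\<lambda>n. b n t) (\<lambda>n. c n t) 0)) ** C0 (\<lambda>n. a n t))"
    and U_0: "linear_functional u1" "linear_functional u2" "U 0 = functional_pair u1 u2"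
    and U_exp:
      "\<And>t. \<exists>M. U t = right_mult (functional_pair (exp_functional t u1) (exp_functional t u2)) M"
  shows "\<forall>n\<ge>1. \<forall>t.
      (a n has_vector_derivative b n t - b (n - 1) t) (at t) \<and>
      (b n has_vector_derivative b n t * (a (n + 1) t - a n t) + c n t - c (n - 1) t) (at t) \<and>
      (c n has_vector_derivative c n t * (a (n + 2) t - a n t)) (at t)"
proof (intro allI impI)
  fix n t
  assume n: "(1::nat) \<le> n"
  define P where "P s = rec_poly (\<lambda>n. a n s) (\<lambda>n. b n s) (\<lambda>n. c n s)" for s
  obtain K where K: "K > 0" "\<And>n s. n \<ge> 1 \<Longrightarrow> cmod (a n s) \<le> K"
    "\<And>n s. n \<ge> 1 \<Longrightarrow> cmod (b n s) \<le> K" "\<And>n s. n \<ge> 1 \<Longrightarrow> cmod (c n s) \<le> K"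
    using bounded by auto
  \<comment> \<open>Time 0 with \<open>M = mat 1\<close>: this gives the moment bounds for
    \<open>u1\<close> and \<open>u2\<close>.\<close>
  have "right_mult (W 0) (matrix_inv (W 0 (block (\<lambda>n. a n 0) (\<lambda>n. b n 0) (\<lambda>n. c n 0) 0))
      ** C0 (\<lambda>n. a n 0)) = right_mult (functional_pair u1 u2) (mat 1)"
    using U_0(3) U_eq [of 0] by (simp add: right_mult_def fun_eq_iff)
  note u = functional_pair_vanish [OF W_associated W_invertible this]
  obtain B1 where B1: "\<And>k. cmod (u1 (monom 1 k)) \<le> B1 * (3 * K + 1) ^ k"
    by (rule moment_bound [of u1 "\<lambda>n. b n 0" "\<lambda>n. c n 0" K "\<lambda>n. a n 0"])
      (use K U_0(1) u(1) index_0 in auto)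
  obtain B2 where B2: "\<And>k. cmod (u2 (monom 1 k)) \<le> B2 * (3 * K + 1) ^ k"
    by (rule moment_bound [of u2 "\<lambda>n. b n 0" "\<lambda>n. c n 0" K "\<lambda>n. a n 0"])
      (use K U_0(2) u(2) index_0 in auto)
  define e1 e2 where "e1 s = exp_functional s u1" and "e2 s = exp_functional s u2" for s
  have e: "n \<ge> 2 \<Longrightarrow> e1 s (P s n) = 0" "n \<ge> 2 \<Longrightarrow> e2 s (P s n) = 0"
    "e1 s (P s 0) * e2 s (P s 1) - e2 s (P s 0) * e1 s (P s 1) \<noteq> 0" for n s
  proof -
    obtain M where "right_mult (W s)
        (matrix_inv (W s (block (\<lambda>n. a n s) (\<lambda>n. b n s) (\<lambda>n. c n s) 0)) ** C0 (\<lambda>n. a n s))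
      = right_mult (functional_pair (e1 s) (e2 s)) M"
      using U_eq U_exp unfolding e1_def e2_def by metis
    from functional_pair_vanish [OF W_associated W_invertible this]
    show "n \<ge> 2 \<Longrightarrow> e1 s (P s n) = 0" "n \<ge> 2 \<Longrightarrow> e2 s (P s n) = 0"
      "e1 s (P s 0) * e2 s (P s 1) - e2 s (P s 0) * e1 s (P s 1) \<noteq> 0"
      unfolding P_def by blast+
  qed

  define da db dc where "da n = vector_derivative (a n) (at t)"
    and "db n = vector_derivative (b n) (at t)" and "dc n = vector_derivative (c n) (at t)" for n
  have zero: "b 0 = (\<lambda>_. 0)" "c 0 = (\<lambda>_. 0)"
    using index_0 by auto
  have deriv: "n \<ge> 1 \<Longrightarrow> (a n has_vector_derivative da n) (at t)"
    "(b n has_vector_derivative db n) (at t)" "(c n has_vector_derivative dc n) (at t)" for n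
    using differentiable zero unfolding da_def db_def dc_def
    by (cases "n = 0"; auto simp flip: vector_derivative_works)+
  define dP where "dP = rec_poly_deriv (\<lambda>n. a n t) (\<lambda>n. b n t) (\<lambda>n. c n t) da db dc"
  have e_deriv: "e (dP n) + e (pCons 0 (P t n)) = 0"
    if "n \<ge> 2" "e \<in> {e1 t, e2 t}" for n e
  proof -
    have "v t (dP n) + v t (pCons 0 (P t n)) = 0"
      if v: "v = (\<lambda>s. exp_functional s u)" "\<And>s. v s (P s n) = 0"
        "\<And>k. cmod (u (monom 1 k)) \<le> B * (3 * K + 1) ^ k" for v u B
    proof -
      have "((\<lambda>s. v s (monom 1 0 * P s n)) has_vector_derivative
          v t (monom 1 (Suc 0) * P t n + monom 1 0 * dP n)) (at t)"
        unfolding P_def dP_def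
        by (rule functional_rec_poly_deriv)
          (auto simp: v(1) linear_exp_functional index_0 intro: deriv exp_functional_monom_deriv v(3))
      \<comment> \<open>The differentiated function is identically zero in \<open>s\<close>, so its
        derivative vanishes.\<close>
      then have "((\<lambda>s. 0) has_vector_derivative v t (pCons 0 (P t n) + dP n)) (at t)"
        by (simp add: v(2) monom_Suc)
      then have "v t (pCons 0 (P t n) + dP n) = 0"
        by (metis has_vector_derivative_const vector_derivative_unique_at)
      then show ?thesis
        using linear_exp_functional [of t u]
        by (simp add: v(1) linear_functional_add add.commute)
    qed
    from this [of e1 u1 B1] this [of e2 u2 B2] show ?thesis
      using that B1 B2 e(1,2) unfolding e1_def e2_def by blast
  qed

  \<comment> \<open>Cramer's rule: \<open>\<phi>\<close> and \<open>\<psi>\<close> are the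
    combinations of \<open>e1 t\<close>, \<open>e2 t\<close> dual to P_0, P_1.\<close>
  define \<Delta> where "\<Delta> = e1 t (P t 0) * e2 t (P t 1) - e2 t (P t 0) * e1 t (P t 1)"
  define \<phi> where "\<phi> q = (e2 t (P t 1) * e1 t q - e1 t (P t 1) * e2 t q) / \<Delta>" for q
  define \<psi> where "\<psi> q = (e1 t (P t 0) * e2 t q - e2 t (P t 0) * e1 t q) / \<Delta>" for q
  have \<Delta>: "\<Delta> \<noteq> 0"
    using e(3) by (simp add: \<Delta>_def)
  have lin: "linear_functional (e1 t)" "linear_functional (e2 t)"
    by (simp_all add: e1_def e2_def linear_exp_functional)
  interpret recurrence_flow "\<lambda>n. a n t" "\<lambda>n. b n t" "\<lambda>n. c n t" da db dc "P t" dP \<phi> \<psi>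
  proof (rule recurrence_flow.intro)
    show "P t (Suc n) = pCons 0 (P t n) - smult (a (Suc n) t) (P t n)
      - smult (b n t) (P t (n - 1)) - smult (c (n - 1) t) (P t (n - 2))" for n
      unfolding P_def by (rule rec_poly_Suc) (simp_all add: index_0)
    show "linear_functional \<phi>" "linear_functional \<psi>"
      unfolding \<phi>_def \<psi>_def by (intro linear_functional_combination lin)+
    show "\<phi> (P t n) = (if n = 0 then 1 else 0)" for n
    proof -
      consider "n = 0" | "n = 1" | "n \<ge> 2" by linarith
      then show ?thesis
        using \<Delta> by cases (auto simp: \<phi>_def \<Delta>_def e(1,2) mult.commute)
    qed
    show "\<psi> (P t n) = (if n = 1 then 1 else 0)" for n
    proof -
      consider "n = 0" | "n = 1" | "n \<ge> 2" by linarith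
      then show ?thesis
        using \<Delta> by cases (auto simp: \<psi>_def \<Delta>_def e(1,2) mult.commute)
    qed
    show "\<phi> (dP n) + \<phi> (pCons 0 (P t n)) = 0" "\<psi> (dP n) + \<psi> (pCons 0 (P t n)) = 0"
      if "n \<ge> 2" for n
    proof -
      have "e1 t (dP n) = - e1 t (pCons 0 (P t n))" "e2 t (dP n) = - e2 t (pCons 0 (P t n))"
        using e_deriv [OF that, of "e1 t"] e_deriv [OF that, of "e2 t"]
        by (simp_all add: eq_neg_iff_add_eq_0)
      then show "\<phi> (dP n) + \<phi> (pCons 0 (P t n)) = 0" "\<psi> (dP n) + \<psi> (pCons 0 (P t n)) = 0"
        by (simp_all add: \<phi>_def \<psi>_def field_simps \<Delta>)
    qed
    show "da 1 = b 1 t"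
      using vector_derivative_at [OF deriv_a1] by (simp add: da_def)
    show "c n t \<noteq> 0" if "n \<ge> 1" for n
      using c_nonzero that .
  qed (simp_all add: index_0 zero db_def dc_def dP_def P_def)
  show "(a n has_vector_derivative b n t - b (n - 1) t) (at t) \<and>
      (b n has_vector_derivative b n t * (a (n + 1) t - a n t) + c n t - c (n - 1) t) (at t) \<and>
      (c n has_vector_derivative c n t * (a (n + 2) t - a n t)) (at t)"
    using deriv(1) [OF n] deriv(2,3) [of n] unfolding toda_equations [OF n] by blast
qed

end
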